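(* Let $X_1,X_2,\ldots$ be i.i.d. exponentially distributed random variables with density $\lambda e^{-\lambda x}$, $x\ge 0$, for some $\lambda>0$, and let $I_n^{(3)}$ be the statistic defined in the context. Then, as $n\to\infty$, $$\sqrt n\,I_n^{(3)}\ \xrightarrow{\ d\ }\ \mathcal N\left(0,\frac{14591}{1921920}\right).$$
   Context: For $t\ge 0$ and a sample $X_1,\ldots,X_n$ put $$H_n^{(3)}(t)=\frac1{n^3}\sum_{i_1,i_2,i_3=1}^n \mathbf 1\{\max(X_{i_1},X_{i_2},X_{i_3})<t\},$$ $$G_n^{(3)}(t)=\frac1{3!\,n^3}\sum_{i_1,i_2,i_3=1}^n\ \sum_{(j_1,j_2,j_3)}\mathbf 1\left\{\frac{X_{i_1}}{j_1}+\frac{X_{i_2}}{j_2}+\frac{X_{i_3}}{j_3}<t\right\},$$ where the inner sum runs over all $3!$ permutations $(j_1,j_2,j_3)$ of $(1,2,3)$. Let $F_n(t)=n^{-1}\sum_{i=1}^n\mathbf 1\{X_i<t\}$ be the empirical distribution function. The statistic is $$I_n^{(3)}=\int_0^\infty\left(H_n^{(3)}(t)-G_n^{(3)}(t)\right)dF_n(t)=\frac1n\sum_{l=1}^n\left(H_n^{(3)}(X_l)-G_n^{(3)}(X_l)\right).$$ $\mathcal N(0,\sigma^2)$ denotes the normal law with mean $0$ and variance $\sigma^2$, and $\xrightarrow{d}$ denotes convergence in distribution. *)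

theory Defs
  imports "HOL-Probability.Probability" "HOL-Combinatorics.Permutations"
begin

text \<open>
  A sample of size \<open>n\<close> is given by the first \<open>n\<close> terms of a sequence \<open>x :: nat \<Rightarrow> real\<close>, indexed
  from \<open>0\<close>: the informal \<open>X\<^sub>1, \<dots>, X\<^sub>n\<close> are \<open>x 0, \<dots>, x (n - 1)\<close>.
\<close>

definition emp_df :: "nat \<Rightarrow> (nat \<Rightarrow> real) \<Rightarrow> real \<Rightarrow> real" where
  "emp_df n x t = (\<Sum>i<n. of_bool (x i < t)) / real n"

definition H3 :: "nat \<Rightarrow> (nat \<Rightarrow> real) \<Rightarrow> real \<Rightarrow> real" where
  "H3 n x t =
     1 / real n ^ 3 *
     (\<Sum>i1<n. \<Sum>i2<n. \<Sum>i3<n. of_bool (max (x i1) (max (x i2) (x i3)) < t))"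

definition G3 :: "nat \<Rightarrow> (nat \<Rightarrow> real) \<Rightarrow> real \<Rightarrow> real" where
  "G3 n x t =
     1 / (fact 3 * real n ^ 3) *
     (\<Sum>i1<n. \<Sum>i2<n. \<Sum>i3<n. \<Sum>j | j permutes {1..3::nat}.
        of_bool (x i1 / real (j 1) + x i2 / real (j 2) + x i3 / real (j 3) < t))"

definition I3 :: "nat \<Rightarrow> (nat \<Rightarrow> real) \<Rightarrow> real" where
  "I3 n x = 1 / real n * (\<Sum>l<n. H3 n x (x l) - G3 n x (x l))"

text \<open>
  \<open>I3\<close> is the integral of \<open>H3 - G3\<close> over \<open>[0, \<infinity>)\<close> with respect to \<open>emp_df\<close>. As \<open>emp_df\<close> is
  left-continuous (strict inequality), its Stieltjes measure is characterised by the values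
  on the rays \<open>{..<t}\<close>.
\<close>

definition emp_measure :: "nat \<Rightarrow> (nat \<Rightarrow> real) \<Rightarrow> real measure" where
  "emp_measure n x = distr (uniform_count_measure {..<n}) borel x"

lemma measure_emp_measure_lessThan:
  assumes "n > 0"
  shows "measure (emp_measure n x) {..<t} = emp_df n x t"
proof -
  have "measure (emp_measure n x) {..<t} = measure (uniform_count_measure {..<n}) {i\<in>{..<n}. x i < t}"
    unfolding emp_measure_def
    by (subst measure_distr)
       (auto simp: space_uniform_count_measure measurable_def sets_uniform_count_measure
             intro!: arg_cong[where f = "measure _"])
  also have "\<dots> = real (card {i\<in>{..<n}. x i < t}) / real n"
    by (subst measure_uniform_count_measure) auto
  also have "\<dots> = emp_df n x t"
    unfolding emp_df_def by (simp add: sum.If_cases of_bool_def Int_def)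
  finally show ?thesis .
qed

lemma borel_measurable_H3_G3: "(\<lambda>t. H3 n x t - G3 n x t) \<in> borel_measurable borel"
  unfolding H3_def G3_def of_bool_def by measurable

lemma I3_eq_integral:
  assumes "n > 0" "\<And>i. i < n \<Longrightarrow> 0 \<le> x i"
  shows "I3 n x = (LINT t:{0..}|emp_measure n x. H3 n x t - G3 n x t)"
proof -
  have x: "x \<in> measurable (uniform_count_measure {..<n}) borel"
    by (simp add: measurable_def space_uniform_count_measure sets_uniform_count_measure)
  have "(LINT t:{0..}|emp_measure n x. H3 n x t - G3 n x t) =
        (LINT i|uniform_count_measure {..<n}. indicator {0..} (x i) *\<^sub>R (H3 n x (x i) - G3 n x (x i)))"
    unfolding emp_measure_def set_lebesgue_integral_def
    by (subst integral_distr[OF x])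
       (auto intro!: borel_measurable_scaleR borel_measurable_indicator borel_measurable_H3_G3
             simp del: real_scaleR_def)
  also have "\<dots> = (\<Sum>i<n. indicator {0..} (x i) *\<^sub>R (H3 n x (x i) - G3 n x (x i))) / real n"
    unfolding uniform_count_measure_def
    using assms(1)
    by (subst lebesgue_integral_point_measure_finite)
       (simp_all add: sum_divide_distrib del: sum.If_cases sum_mult_indicator sum_indicator_mult indicator_simps)
  also have "\<dots> = I3 n x"
    unfolding I3_def using assms(2) by (auto intro!: sum.cong)
  finally show ?thesis by simp
qed

end

theory Submission
  imports Defs
begin

text \<open>
  The statistic \<open>I3\<close> is a V-statistic of degree four with the bounded kernel \<open>I3_kernel\<close>: the indicator
  that the fourth observation exceeds the maximum of the first three, minus the indicator that it
  exceeds \<open>a + b / 2 + c / 3\<close>. For exponential variables these two events are equally likely, even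
  given the fourth observation (Renyi's representation of the maximum, \<open>integral_max_cdf\<close>), so the
  kernel has mean zero. The asymptotics follow from Hoeffding's projection method.

  The conditional expectations of the kernel given one of its first three arguments are explicit
  combinations of exponentials (\<open>proj\<close>). Their sum \<open>score\<close> is bounded, has mean zero and, by direct
  integration, second moment \<open>14591 / 1921920\<close> (\<open>integral_score_square\<close>). The central limit theorem
  gives the asserted normal limit for the sum of the scores divided by \<open>sqrt n\<close>.

  It remains to see that \<open>sqrt n * I3\<close> differs from this sum by a term that vanishes in mean square. The
  kernel minus its projections (\<open>remainder\<close>) is degenerate: it has conditional expectation zero given any
  one argument (\<open>degenerate_remainder\<close>). In the second moment of its sum over \<open>n ^ 4\<close> quadruples, a pair
  of quadruples with seven or more distinct indices therefore contributes nothing, since one of the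
  quadruples has four distinct indices, at most one of them in the other. There are only \<open>O(n ^ 6)\<close> other pairs (\<open>card_few_indices_le\<close>), so the second moment is \<open>O(n ^ 6)\<close> (\<open>degenerate_second_moment\<close>), while the
  normalization \<open>n ^ (- 7 / 2)\<close> would let \<open>o(n ^ 7)\<close> pass. A perturbation that is small in mean square does
  not affect weak limits (\<open>weak_conv_m_L2_perturbation\<close>).
\<close>

section \<open>The statistic as a V-statistic\<close>

lemma sum_permutes_3:
  fixes f :: "nat \<Rightarrow> nat \<Rightarrow> nat \<Rightarrow> real"
  shows "(\<Sum>j | j permutes {1..3::nat}. f (j 1) (j 2) (j 3)) =
    f 1 2 3 + f 1 3 2 + f 2 1 3 + f 2 3 1 + f 3 1 2 + f 3 2 1"
proof -
  have e: "{1..3::nat} = {1, 2, 3}" by auto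
  have f123: "finite {2::nat, 3}" "1 \<notin> {2::nat, 3}" and f23: "finite {3::nat}" "2 \<notin> {3::nat}"
    by auto
  show ?thesis
    unfolding e sum_over_permutations_insert[OF f123] sum_over_permutations_insert[OF f23] permutes_sing
    by (simp add: transpose_def)
qed

lemma G3_eq:
  "G3 n x t = (\<Sum>i1<n. \<Sum>i2<n. \<Sum>i3<n. of_bool (x i1 + x i2 / 2 + x i3 / 3 < t)) / real n ^ 3"
proof -
  define g :: "nat \<Rightarrow> nat \<Rightarrow> nat \<Rightarrow> real"
    where "g i j k = of_bool (x i + x j / 2 + x k / 3 < t)" for i j k
  let ?S = "\<Sum>i1<n. \<Sum>i2<n. \<Sum>i3<n. g i1 i2 i3"
  have "(\<Sum>i1<n. \<Sum>i2<n. \<Sum>i3<n. \<Sum>j | j permutes {1..3::nat}.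
           of_bool (x i1 / real (j 1) + x i2 / real (j 2) + x i3 / real (j 3) < t)) =
        (\<Sum>i1<n. \<Sum>i2<n. \<Sum>i3<n. g i1 i2 i3 + g i1 i3 i2 + g i2 i1 i3 + g i3 i1 i2
           + g i2 i3 i1 + g i3 i2 i1)"
    by (subst sum_permutes_3[where f = "\<lambda>a b c. of_bool (x _ / real a + x _ / real b + x _ / real c < t)"])
       (simp add: g_def algebra_simps)
  also have "\<dots> = 6 * ?S"
  proof -
    have 1: "(\<Sum>i1<n. \<Sum>i2<n. \<Sum>i3<n. h i1 i3 i2) = (\<Sum>i1<n. \<Sum>i2<n. \<Sum>i3<n. h i1 i2 i3)"
      for h :: "nat \<Rightarrow> nat \<Rightarrow> nat \<Rightarrow> real"
      by (intro sum.cong refl sum.swap)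
    have 2: "(\<Sum>i1<n. \<Sum>i2<n. \<Sum>i3<n. h i2 i1 i3) = (\<Sum>i1<n. \<Sum>i2<n. \<Sum>i3<n. h i1 i2 i3)"
      for h :: "nat \<Rightarrow> nat \<Rightarrow> nat \<Rightarrow> real"
      by (rule sum.swap)
    have "(\<Sum>i1<n. \<Sum>i2<n. \<Sum>i3<n. g i1 i3 i2) = ?S" "(\<Sum>i1<n. \<Sum>i2<n. \<Sum>i3<n. g i2 i1 i3) = ?S"
      "(\<Sum>i1<n. \<Sum>i2<n. \<Sum>i3<n. g i3 i1 i2) = ?S" "(\<Sum>i1<n. \<Sum>i2<n. \<Sum>i3<n. g i2 i3 i1) = ?S"
      "(\<Sum>i1<n. \<Sum>i2<n. \<Sum>i3<n. g i3 i2 i1) = ?S"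
      using 1[of g] 2[of g] 1[of "\<lambda>a b c. g b a c"] 2[of "\<lambda>a b c. g a c b"] 1[of "\<lambda>a b c. g b c a"]
      by simp_all
    then show ?thesis by (simp add: sum.distrib)
  qed
  finally show ?thesis
    unfolding G3_def g_def by (simp add: fact_numeral)
qed

text \<open>
  All six permutations give the same triple sum after renaming the summation indices, so one of
  them is enough; the resulting kernel is not symmetric in its first three arguments.
\<close>

definition I3_kernel :: "real \<Rightarrow> real \<Rightarrow> real \<Rightarrow> real \<Rightarrow> real" where
  "I3_kernel a b c d = of_bool (max a (max b c) < d) - of_bool (a + b / 2 + c / 3 < d)"

abbreviation quads :: "nat \<Rightarrow> (nat \<times> nat \<times> nat \<times> nat) set" where
  "quads n \<equiv> {..<n} \<times> {..<n} \<times> {..<n} \<times> {..<n}"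

lemma sum_quads:
  fixes f :: "nat \<Rightarrow> nat \<Rightarrow> nat \<Rightarrow> nat \<Rightarrow> real"
  shows "(\<Sum>(i, j, k, l)\<in>quads n. f i j k l) = (\<Sum>i<n. \<Sum>j<n. \<Sum>k<n. \<Sum>l<n. f i j k l)"
  by (simp add: sum.cartesian_product)

lemma I3_eq: "I3 n x = (\<Sum>(i, j, k, l)\<in>quads n. I3_kernel (x i) (x j) (x k) (x l)) / real n ^ 4"
proof -
  have "(\<Sum>l<n. H3 n x (x l) - G3 n x (x l)) =
    (\<Sum>l<n. \<Sum>i<n. \<Sum>j<n. \<Sum>k<n. I3_kernel (x i) (x j) (x k) (x l)) / real n ^ 3"
    by (simp add: G3_eq H3_def I3_kernel_def sum_subtractf diff_divide_distrib sum_divide_distrib)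
  also have "(\<Sum>l<n. \<Sum>i<n. \<Sum>j<n. \<Sum>k<n. I3_kernel (x i) (x j) (x k) (x l)) =
    (\<Sum>i<n. \<Sum>j<n. \<Sum>k<n. \<Sum>l<n. I3_kernel (x i) (x j) (x k) (x l))"
  proof -
    have "(\<Sum>l<n. \<Sum>i<n. \<Sum>j<n. \<Sum>k<n. f i j k l) = (\<Sum>i<n. \<Sum>l<n. \<Sum>j<n. \<Sum>k<n. f i j k l)"
      for f :: "nat \<Rightarrow> nat \<Rightarrow> nat \<Rightarrow> nat \<Rightarrow> real"
      by (rule sum.swap)
    also have "(\<Sum>i<n. \<Sum>l<n. \<Sum>j<n. \<Sum>k<n. f i j k l) = (\<Sum>i<n. \<Sum>j<n. \<Sum>l<n. \<Sum>k<n. f i j k l)"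
      for f :: "nat \<Rightarrow> nat \<Rightarrow> nat \<Rightarrow> nat \<Rightarrow> real"
      by (intro sum.cong refl sum.swap)
    also have "(\<Sum>i<n. \<Sum>j<n. \<Sum>l<n. \<Sum>k<n. f i j k l) = (\<Sum>i<n. \<Sum>j<n. \<Sum>k<n. \<Sum>l<n. f i j k l)"
      for f :: "nat \<Rightarrow> nat \<Rightarrow> nat \<Rightarrow> nat \<Rightarrow> real"
      by (intro sum.cong refl sum.swap)
    finally show ?thesis .
  qed
  finally show ?thesis
    unfolding I3_def sum_quads by (simp add: power_numeral_reduce)
qed

abbreviation quad_set :: "nat \<times> nat \<times> nat \<times> nat \<Rightarrow> nat set" where
  "quad_set \<equiv> (\<lambda>(i, j, k, l). {i, j, k, l})"

text \<open>
  A pair of quadruples with at most six distinct entries factors as eight positions mapped to six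
  labels, followed by a map from labels to indices. The crude constant \<open>6 ^ 8\<close> is harmless: what
  matters is the order \<open>n ^ 6\<close>, two powers below the total number \<open>n ^ 8\<close> of pairs.
\<close>

lemma card_few_indices_le:
  "card {(p, q) \<in> quads n \<times> quads n. card (quad_set p \<union> quad_set q) \<le> 6} \<le> 6 ^ 8 * n ^ 6"
    (is "card ?B \<le> _")
proof -
  define F where "F = (\<lambda>(s :: nat \<Rightarrow> nat, g :: nat \<Rightarrow> nat).
    ((g (s 0), g (s 1), g (s 2), g (s 3)), (g (s 4), g (s 5), g (s 6), g (s 7))))"
  let ?D = "({..<8::nat} \<rightarrow>\<^sub>E {..<6::nat}) \<times> ({..<6::nat} \<rightarrow>\<^sub>E {..<n})"
  have "?B \<subseteq> F ` ?D"
  proof (rule subsetI)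
    fix z assume z: "z \<in> ?B"
    obtain a b c d a' b' c' d' where zz: "z = ((a, b, c, d), (a', b', c', d'))"
      by (metis surj_pair)
    define S where "S = {a, b, c, d, a', b', c', d'}"
    have S: "S \<subseteq> {..<n}" "card S \<le> 6" "finite S"
      using z unfolding zz S_def by simp_all
    obtain h where h: "bij_betw h S {..<card S}"
      using ex_bij_betw_finite_nat[OF S(3)] by (auto simp: atLeast0LessThan)
    define s where "s = (\<lambda>m\<in>{..<8::nat}. h ([a, b, c, d, a', b', c', d'] ! m))"
    define g where "g = (\<lambda>m\<in>{..<6::nat}. if m < card S then inv_into S h m else a)"
    have hS: "h y < 6" "h y < card S" if "y \<in> S" for y
      using bij_betwE[OF h] that S(2) by (auto intro: less_le_trans)
    have inv: "inv_into S h (h y) = y" if "y \<in> S" for y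
      using that h by (simp add: bij_betw_inv_into_left)
    have "s \<in> {..<8} \<rightarrow>\<^sub>E {..<6}"
    proof (rule PiE_I)
      fix m :: nat assume m: "m \<in> {..<8}"
      have "set [a, b, c, d, a', b', c', d'] \<subseteq> S" by (auto simp: S_def)
      moreover have "[a, b, c, d, a', b', c', d'] ! m \<in> set [a, b, c, d, a', b', c', d']"
        using m by (intro nth_mem) simp
      ultimately show "s m \<in> {..<6}" using m hS unfolding s_def by auto
    qed (auto simp: s_def)
    moreover have "g \<in> {..<6} \<rightarrow>\<^sub>E {..<n}"
    proof (rule PiE_I)
      fix m :: nat assume m: "m \<in> {..<6}"
      have "inv_into S h m \<in> S" if "m < card S"
        using that h by (metis bij_betw_def inv_into_into lessThan_iff)
      moreover have "a \<in> S" by (simp add: S_def)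
      ultimately show "g m \<in> {..<n}" using m S(1) unfolding g_def by auto
    qed (auto simp: g_def)
    moreover have "z = F (s, g)"
      unfolding zz F_def s_def g_def using hS inv
      by (simp add: S_def)
    ultimately show "z \<in> F ` ?D" by blast
  qed
  then have "card ?B \<le> card (F ` ?D)"
    by (intro card_mono finite_imageI finite_cartesian_product finite_PiE) auto
  also have "\<dots> \<le> card ?D"
    by (intro card_image_le finite_cartesian_product finite_PiE) auto
  also have "\<dots> = 6 ^ 8 * n ^ 6"
    by (simp add: card_cartesian_product card_PiE)
  finally show ?thesis .
qed

text \<open>
  Seven distinct entries leave room for at most one coincidence among eight positions. Hence one
  of the two quadruples is injective and shares at most one index \<open>e\<close> with the other one.
\<close>

lemma seven_distinct_cases:
  assumes "card ({a, b, c, d} \<union> {a', b', c', d'}) > 6"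
  shows "(distinct [a, b, c, d] \<and>
      (\<exists>e\<in>{a, b, c, d}. ({a, b, c, d} - {e}) \<inter> {a', b', c', d'} = {})) \<or>
    (distinct [a', b', c', d'] \<and>
      (\<exists>e\<in>{a', b', c', d'}. ({a', b', c', d'} - {e}) \<inter> {a, b, c, d} = {}))"
proof -
  define A where "A = {a, b, c, d}"
  define B where "B = {a', b', c', d'}"
  have fin: "finite A" "finite B" by (simp_all add: A_def B_def)
  have le: "card A \<le> 4" "card B \<le> 4"
    using card_length[of "[a, b, c, d]"] card_length[of "[a', b', c', d']"]
    by (simp_all add: A_def B_def)
  have un: "card (A \<union> B) + card (A \<inter> B) = card A + card B"
    using card_Un_Int[OF fin] by simp
  have gt: "card (A \<union> B) > 6" using assms unfolding A_def B_def .
  have int: "card (A \<inter> B) \<le> Suc 0" using le un gt by linarith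
  have dis: "distinct [a, b, c, d]" if "card A = 4"
    by (rule card_distinct) (use that in \<open>simp add: A_def\<close>)
  have dis': "distinct [a', b', c', d']" if "card B = 4"
    by (rule card_distinct) (use that in \<open>simp add: B_def\<close>)
  have "a \<in> A" "a' \<in> B" by (simp_all add: A_def B_def)
  have eq: "x = y" if "x \<in> A \<inter> B" "y \<in> A \<inter> B" for x y
    using int that fin card_le_Suc0_iff_eq[of "A \<inter> B"] by blast
  \<comment> \<open>If the quadruples are disjoint, any element of the first one serves as \<open>e\<close>.\<close>
  obtain e where e: "e \<in> A" "A \<inter> B \<subseteq> {e}"
    using eq \<open>a \<in> A\<close> by (cases "A \<inter> B = {}") blast+
  have "(distinct [a, b, c, d] \<and> (\<exists>e\<in>A. (A - {e}) \<inter> B = {})) \<or>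
    (distinct [a', b', c', d'] \<and> (\<exists>e\<in>B. (B - {e}) \<inter> A = {}))"
  proof (cases "card A = 4")
    case True
    then show ?thesis using e dis by blast
  next
    case False
    then have "card B = 4" "card (A \<inter> B) = 0" using le un gt by linarith+
    then have "A \<inter> B = {}" using fin by simp
    then show ?thesis using dis' \<open>card B = 4\<close> \<open>a' \<in> B\<close> by blast
  qed
  then show ?thesis unfolding A_def B_def .
qed

section \<open>Second moment of a degenerate V-statistic\<close>

context real_distribution
begin

abbreviation iid :: "(nat \<Rightarrow> real) measure" where
  "iid \<equiv> Pi\<^sub>M UNIV (\<lambda>_. M)"

lemma prob_space_iid: "prob_space iid"
  by (intro prob_space_PiM prob_space_axioms)

lemma measurable_fun_upd_iid:
  "(\<lambda>(t, x). x(i := t)) \<in> M \<Otimes>\<^sub>M iid \<rightarrow>\<^sub>M iid"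
proof -
  have "(\<lambda>p. (snd p)(i := fst p)) \<in> M \<Otimes>\<^sub>M iid \<rightarrow>\<^sub>M iid"
    by (rule measurable_fun_upd[where J = UNIV]) auto
  then show ?thesis by (simp add: case_prod_beta')
qed

lemma measurable_integral_fun_upd:
  fixes f :: "(nat \<Rightarrow> real) \<Rightarrow> real"
  assumes "f \<in> borel_measurable iid"
  shows "(\<lambda>x. \<integral>t. f (x(i := t)) \<partial>M) \<in> borel_measurable iid"
proof (rule borel_measurable_lebesgue_integral)
  have "(\<lambda>p. (fst p)(i := snd p)) \<in> iid \<Otimes>\<^sub>M M \<rightarrow>\<^sub>M iid"
    by (rule measurable_fun_upd[where J = UNIV]) auto
  then show "(\<lambda>(x, t). f (x(i := t))) \<in> borel_measurable (iid \<Otimes>\<^sub>M M)"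
    using assms by (simp add: case_prod_beta' measurable_compose)
qed

lemma abs_integral_le_bound:
  fixes f :: "real \<Rightarrow> real"
  assumes "\<And>t. \<bar>f t\<bar> \<le> C"
  shows "\<bar>\<integral>t. f t \<partial>M\<bar> \<le> C"
proof (cases "integrable M f")
  case True
  have "\<bar>\<integral>t. f t \<partial>M\<bar> \<le> (\<integral>t. \<bar>f t\<bar> \<partial>M)" by (rule integral_abs_bound)
  also have "\<dots> \<le> (\<integral>t. C \<partial>M)"
    using True assms by (intro integral_mono) auto
  finally show ?thesis by (simp add: prob_space del: space_eq_univ)
next
  case False
  then show ?thesis using assms[of 0] by (simp add: not_integrable_integral_eq)
qed

text \<open>
  Replacing one coordinate by a fresh independent copy does not change the law of the sequence;
  Fubini then integrates the fresh copy first. This takes the place of conditional expectations.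
\<close>

lemma integral_iid_resample:
  fixes f :: "(nat \<Rightarrow> real) \<Rightarrow> real"
  assumes f[measurable]: "f \<in> borel_measurable iid" and b: "\<And>x. \<bar>f x\<bar> \<le> C"
  shows "(\<integral>x. f x \<partial>iid) = (\<integral>x. (\<integral>t. f (x(i := t)) \<partial>M) \<partial>iid)"
proof -
  interpret I: prob_space iid by (rule prob_space_iid)
  interpret P: pair_prob_space M iid ..
  note [measurable] = measurable_fun_upd_iid[of i]
  have "iid = distr (M \<Otimes>\<^sub>M iid) iid (\<lambda>(t, x). x(i := t))"
    using distr_pair_PiM_eq_PiM[of UNIV "\<lambda>_. M" i] prob_space_axioms by simp
  then have "(\<integral>x. f x \<partial>iid) = (\<integral>x. f x \<partial>distr (M \<Otimes>\<^sub>M iid) iid (\<lambda>(t, x). x(i := t)))"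
    by simp
  also have "\<dots> = (\<integral>p. f ((\<lambda>(t, x). x(i := t)) p) \<partial>(M \<Otimes>\<^sub>M iid))"
    by (rule integral_distr) measurable
  also have "\<dots> = (\<integral>(t, x). f (x(i := t)) \<partial>(M \<Otimes>\<^sub>M iid))"
    by (simp add: case_prod_beta')
  also have "\<dots> = (\<integral>x. (\<integral>t. f (x(i := t)) \<partial>M) \<partial>iid)"
  proof (rule P.integral_snd[symmetric])
    have "(\<lambda>p. f ((\<lambda>(t, x). x(i := t)) p)) \<in> borel_measurable (M \<Otimes>\<^sub>M iid)" by measurable
    then show "integrable (M \<Otimes>\<^sub>M iid) (\<lambda>(t, x). f (x(i := t)))"
      using b by (intro P.integrable_const_bound[where B = C]) (auto simp: case_prod_beta')
  qed
  finally show ?thesis .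
qed

text \<open>
  The bound is uniform in \<open>x\<close>, so it passes to the inner integrals and resampling can be repeated.
\<close>

lemma integral_iid_eq_zero:
  fixes f :: "(nat \<Rightarrow> real) \<Rightarrow> real"
  assumes f: "f \<in> borel_measurable iid" and b: "\<And>x. \<bar>f x\<bar> \<le> C"
    and z: "\<And>x. (\<integral>r. (\<integral>s. (\<integral>t. f (x(i := r, j := s, k := t)) \<partial>M) \<partial>M) \<partial>M) = 0"
  shows "(\<integral>x. f x \<partial>iid) = 0"
proof -
  \<comment> \<open>The coordinate resampled first ends up innermost.\<close>
  have "(\<integral>x. f x \<partial>iid) = (\<integral>x. (\<integral>t. f (x(k := t)) \<partial>M) \<partial>iid)"
    by (rule integral_iid_resample[OF f b])
  also have "\<dots> = (\<integral>x. (\<integral>s. (\<integral>t. f (x(j := s, k := t)) \<partial>M) \<partial>M) \<partial>iid)"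
    by (rule integral_iid_resample[of _ C])
       (intro measurable_integral_fun_upd f abs_integral_le_bound b)+
  also have "\<dots> = (\<integral>x. (\<integral>r. (\<integral>s. (\<integral>t. f (x(i := r, j := s, k := t)) \<partial>M) \<partial>M) \<partial>M) \<partial>iid)"
    by (rule integral_iid_resample[of _ C])
       (intro measurable_integral_fun_upd f abs_integral_le_bound b)+
  finally show ?thesis by (simp add: z)
qed

end

text \<open>
  Degeneracy of first order: the conditional expectation given any single argument
  vanishes. The integration orders are the ones in which the kernel below is integrated in closed
  form; as the kernels are bounded, Fubini makes the order irrelevant.
\<close>

definition degenerate :: "real measure \<Rightarrow> (real \<Rightarrow> real \<Rightarrow> real \<Rightarrow> real \<Rightarrow> real) \<Rightarrow> bool" where
  "degenerate M r \<longleftrightarrow>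
    (\<forall>a. (\<integral>b. (\<integral>c. (\<integral>d. r a b c d \<partial>M) \<partial>M) \<partial>M) = 0) \<and>
    (\<forall>b. (\<integral>a. (\<integral>c. (\<integral>d. r a b c d \<partial>M) \<partial>M) \<partial>M) = 0) \<and>
    (\<forall>c. (\<integral>a. (\<integral>b. (\<integral>d. r a b c d \<partial>M) \<partial>M) \<partial>M) = 0) \<and>
    (\<forall>d. (\<integral>c. (\<integral>b. (\<integral>a. r a b c d \<partial>M) \<partial>M) \<partial>M) = 0)"

abbreviation borel4 :: "(real \<times> real \<times> real \<times> real) measure" where
  "borel4 \<equiv> borel \<Otimes>\<^sub>M borel \<Otimes>\<^sub>M borel \<Otimes>\<^sub>M borel"

lemma measurable_quad:
  assumes "(\<lambda>(a, b, c, d). r a b c d) \<in> borel_measurable borel4"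
    and "f \<in> borel_measurable N" "g \<in> borel_measurable N" "h \<in> borel_measurable N" "k \<in> borel_measurable N"
  shows "(\<lambda>x. r (f x) (g x) (h x) (k x)) \<in> borel_measurable N"
proof -
  have "(\<lambda>x. (f x, g x, h x, k x)) \<in> N \<rightarrow>\<^sub>M borel4"
    using assms(2-) by (intro measurable_Pair)
  from measurable_compose[OF this assms(1)] show ?thesis by simp
qed

context real_distribution
begin

lemma borel_measurable_coord: "(\<lambda>x. x i) \<in> borel_measurable iid"
  by (rule measurable_compose[OF measurable_component_singleton[of i UNIV]]) auto

text \<open>
  The second factor depends on none of the three resampled coordinates, so it comes out of the
  inner integrals, and what remains is the conditional expectation of the first factor given its
  argument at index \<open>e\<close>.
\<close>

lemma degenerate_cross_zero:
  fixes r :: "real \<Rightarrow> real \<Rightarrow> real \<Rightarrow> real \<Rightarrow> real"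
  assumes r: "(\<lambda>(a, b, c, d). r a b c d) \<in> borel_measurable borel4"
    and b: "\<And>a b c d. \<bar>r a b c d\<bar> \<le> C"
    and deg: "degenerate M r"
    and dist: "distinct [i, j, k, l]"
    and e: "e \<in> {i, j, k, l}" "({i, j, k, l} - {e}) \<inter> {i', j', k', l'} = {}"
  shows "(\<integral>x. r (x i) (x j) (x k) (x l) * r (x i') (x j') (x k') (x l') \<partial>iid) = 0"
proof -
  let ?f = "\<lambda>x. r (x i) (x j) (x k) (x l) * r (x i') (x j') (x k') (x l')"
  have C: "0 \<le> C" using b[of 0 0 0 0] by linarith
  have m: "?f \<in> borel_measurable iid"
    by (intro borel_measurable_times measurable_quad[OF r] borel_measurable_coord)
  have bd: "\<bar>?f x\<bar> \<le> C * C" for x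
    unfolding abs_mult by (intro mult_mono b C) auto
  note zero = integral_iid_eq_zero[OF m bd]
  from deg have d: "\<And>a. (\<integral>b. (\<integral>c. (\<integral>d. r a b c d \<partial>M) \<partial>M) \<partial>M) = 0"
    "\<And>b. (\<integral>a. (\<integral>c. (\<integral>d. r a b c d \<partial>M) \<partial>M) \<partial>M) = 0"
    "\<And>c. (\<integral>a. (\<integral>b. (\<integral>d. r a b c d \<partial>M) \<partial>M) \<partial>M) = 0"
    "\<And>d. (\<integral>c. (\<integral>b. (\<integral>a. r a b c d \<partial>M) \<partial>M) \<partial>M) = 0"
    by (simp_all add: degenerate_def)
  have ne: "i \<noteq> j" "j \<noteq> i" "i \<noteq> k" "k \<noteq> i" "i \<noteq> l" "l \<noteq> i" "j \<noteq> k" "k \<noteq> j" "j \<noteq> l" "l \<noteq> j"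
    "k \<noteq> l" "l \<noteq> k"
    using dist by auto
  consider "e = i" | "e = j" | "e = k" | "e = l" using e(1) by auto
  then show ?thesis
  proof cases
    case 1
    then have "i' \<notin> {j, k, l}" "j' \<notin> {j, k, l}" "k' \<notin> {j, k, l}" "l' \<notin> {j, k, l}"
      using e(2) dist by auto
    with ne show ?thesis by (intro zero[of j k l]) (simp add: d)
  next
    case 2
    then have "i' \<notin> {i, k, l}" "j' \<notin> {i, k, l}" "k' \<notin> {i, k, l}" "l' \<notin> {i, k, l}"
      using e(2) dist by auto
    with ne show ?thesis by (intro zero[of i k l]) (simp add: d)
  next
    case 3
    then have "i' \<notin> {i, j, l}" "j' \<notin> {i, j, l}" "k' \<notin> {i, j, l}" "l' \<notin> {i, j, l}"
      using e(2) dist by auto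
    with ne show ?thesis by (intro zero[of i j l]) (simp add: d)
  next
    case 4
    then have "i' \<notin> {i, j, k}" "j' \<notin> {i, j, k}" "k' \<notin> {i, j, k}" "l' \<notin> {i, j, k}"
      using e(2) dist by auto
    with ne show ?thesis by (intro zero[of k j i]) (simp add: d)
  qed
qed

text \<open>
  Of the \<open>n ^ 8\<close> products in the expanded square, only the \<open>O(n ^ 6)\<close> with at most six distinct
  indices have a nonzero expectation.
\<close>

lemma degenerate_second_moment:
  fixes r :: "real \<Rightarrow> real \<Rightarrow> real \<Rightarrow> real \<Rightarrow> real"
  assumes r: "(\<lambda>(a, b, c, d). r a b c d) \<in> borel_measurable borel4"
    and b: "\<And>a b c d. \<bar>r a b c d\<bar> \<le> C"
    and deg: "degenerate M r"
  shows "(\<integral>x. (\<Sum>(i, j, k, l)\<in>quads n. r (x i) (x j) (x k) (x l))\<^sup>2 \<partial>iid) \<le> 6 ^ 8 * real n ^ 6 * C\<^sup>2"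
proof -
  interpret I: prob_space iid by (rule prob_space_iid)
  have C: "0 \<le> C" using b[of 0 0 0 0] by linarith
  define R where "R = (\<lambda>(i, j, k, l) (x :: nat \<Rightarrow> real). r (x i) (x j) (x k) (x l))"
  let ?Q = "quads n \<times> quads n"
  define B where "B = {(p, q) \<in> ?Q. card (quad_set p \<union> quad_set q) \<le> 6}"
  have fin: "finite ?Q" by simp
  have m: "R p \<in> borel_measurable iid" for p
    unfolding R_def by (cases p) (auto intro!: measurable_quad[OF r] borel_measurable_coord)
  have bd: "\<bar>R p x * R q x\<bar> \<le> C\<^sup>2" for p q x
  proof -
    have "\<bar>R p x\<bar> \<le> C" "\<bar>R q x\<bar> \<le> C" by (auto simp: R_def b split: prod.split)
    then show ?thesis unfolding abs_mult power2_eq_square using C by (intro mult_mono) auto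
  qed
  have int: "integrable iid (\<lambda>x. R p x * R q x)" for p q
    using bd by (intro I.integrable_const_bound[where B = "C\<^sup>2"] borel_measurable_times m) auto
  have le: "(\<integral>x. R p x * R q x \<partial>iid) \<le> C\<^sup>2" for p q
  proof -
    have "(\<integral>x. R p x * R q x \<partial>iid) \<le> (\<integral>x. C\<^sup>2 \<partial>iid)"
      by (intro integral_mono int abs_le_D1[OF bd]) simp
    then show ?thesis by (simp add: I.prob_space)
  qed
  have zero: "(\<integral>x. R p x * R q x \<partial>iid) = 0" if "(p, q) \<in> ?Q - B" for p q
  proof -
    obtain i j k l where p: "p = (i, j, k, l)" by (metis surj_pair)
    obtain i' j' k' l' where q: "q = (i', j', k', l')" by (metis surj_pair)
    have "card ({i, j, k, l} \<union> {i', j', k', l'}) > 6"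
      using that unfolding B_def p q Diff_iff mem_Collect_eq case_prod_conv by (meson not_le)
    from seven_distinct_cases[OF this] show ?thesis
    proof (elim disjE conjE bexE)
      fix e assume "distinct [i, j, k, l]" "e \<in> {i, j, k, l}" "({i, j, k, l} - {e}) \<inter> {i', j', k', l'} = {}"
      from degenerate_cross_zero[OF r b deg this] show ?thesis by (simp add: R_def p q)
    next
      fix e assume "distinct [i', j', k', l']" "e \<in> {i', j', k', l'}"
        "({i', j', k', l'} - {e}) \<inter> {i, j, k, l} = {}"
      from degenerate_cross_zero[OF r b deg this] show ?thesis by (simp add: R_def p q mult.commute)
    qed
  qed
  have "(\<integral>x. (\<Sum>p\<in>quads n. R p x)\<^sup>2 \<partial>iid) = (\<integral>x. (\<Sum>(p, q)\<in>?Q. R p x * R q x) \<partial>iid)"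
    by (simp only: power2_eq_square sum_product sum.cartesian_product)
  also have "\<dots> = (\<Sum>(p, q)\<in>?Q. \<integral>x. R p x * R q x \<partial>iid)"
    unfolding case_prod_beta' by (rule Bochner_Integration.integral_sum) (rule int)
  also have "\<dots> = (\<Sum>(p, q)\<in>B. \<integral>x. R p x * R q x \<partial>iid)"
  proof (rule sum.mono_neutral_right[OF fin])
    show "B \<subseteq> ?Q" unfolding B_def by blast
    show "\<forall>z\<in>?Q - B. (case z of (p, q) \<Rightarrow> \<integral>x. R p x * R q x \<partial>iid) = 0"
    proof
      fix z assume "z \<in> ?Q - B"
      moreover obtain p q where "z = (p, q)" by (cases z)
      ultimately show "(case z of (p, q) \<Rightarrow> \<integral>x. R p x * R q x \<partial>iid) = 0"
        using zero[of p q] by (simp only: case_prod_conv)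
    qed
  qed
  also have "\<dots> \<le> (\<Sum>(p, q)\<in>B. C\<^sup>2)"
    by (intro sum_mono) (simp add: le case_prod_beta')
  also have "\<dots> = real (card B) * C\<^sup>2"
    by (simp add: case_prod_beta')
  also have "\<dots> \<le> real (6 ^ 8 * n ^ 6) * C\<^sup>2"
  proof (rule mult_right_mono[OF of_nat_mono])
    show "card B \<le> 6 ^ 8 * n ^ 6"
      unfolding B_def by (rule card_few_indices_le)
  qed simp
  finally show ?thesis
    by (simp add: R_def case_prod_beta')
qed

end

section \<open>Exponential expectations and the projection of the kernel\<close>

locale exponential_law =
  fixes L :: real
  assumes L_pos: "0 < L"
begin

definition law :: "real measure" where
  "law = density lborel (exponential_density L)"

text \<open>
  The functions \<open>exp (- a * L * t)\<close> are closed under products and, up to constants, under all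
  integrations below; keeping them behind a constant lets the simplifier do linear algebra on
  them.
\<close>

definition decay :: "real \<Rightarrow> real \<Rightarrow> real" where
  "decay a t = exp (- (a * L * t))"

sublocale law: real_distribution law
proof -
  have "prob_space law" unfolding law_def by (rule prob_space_exponential_density[OF L_pos])
  then show "real_distribution law"
    by (intro real_distribution.intro real_distribution_axioms.intro) (simp_all add: law_def)
qed

lemma measure_law_UNIV [simp]: "measure law UNIV = 1"
  using law.prob_space by simp

lemma decay_measurable [measurable]: "decay a \<in> borel_measurable borel"
  unfolding decay_def by measurable

lemma decay_pos: "0 < decay a t"
  by (simp add: decay_def)

lemma decay_le_1: "0 \<le> a \<Longrightarrow> 0 \<le> t \<Longrightarrow> decay a t \<le> 1"
  using L_pos by (simp add: decay_def)

lemma decay_mult: "decay a t * decay b t = decay (a + b) t"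
  by (simp add: decay_def exp_add[symmetric] algebra_simps)

lemma decay_add: "decay a (s + t) = decay a s * decay a t"
  by (simp add: decay_def exp_add[symmetric] algebra_simps)

lemma decay_power: "decay a t ^ n = decay (real n * a) t"
  by (simp add: decay_def exp_of_nat_mult[symmetric] mult_ac)

lemma decay_divide: "decay a (t / b) = decay (a / b) t"
  by (simp add: decay_def)

lemma integrable_law_bounded:
  fixes f :: "real \<Rightarrow> real"
  assumes "f \<in> borel_measurable borel" "\<And>t. \<bar>f t\<bar> \<le> C"
  shows "integrable law f"
  using assms by (intro law.integrable_const_bound[where B = C]) auto

lemma integrable_decay [simp]: "0 \<le> a \<Longrightarrow> integrable law (\<lambda>t. decay a \<bar>t\<bar>)"
  by (rule integrable_law_bounded[where C = 1])
     (measurable, auto simp: decay_le_1 abs_of_pos decay_pos)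

lemma integrable_decay_max [simp]:
  "0 \<le> a \<Longrightarrow> 0 \<le> r \<Longrightarrow> integrable law (\<lambda>t. decay a (max r \<bar>t\<bar>))"
  by (rule integrable_law_bounded[where C = 1])
     (measurable, auto simp: decay_le_1 abs_of_pos decay_pos)

lemma integral_law:
  fixes f :: "real \<Rightarrow> real"
  assumes "f \<in> borel_measurable borel"
  shows "(\<integral>t. f t \<partial>law) = (\<integral>t. exponential_density L t * f t \<partial>lborel)"
  unfolding law_def using assms L_pos
  by (subst integral_density) (auto simp: exponential_density_nonneg)

lemma exponential_density_decay:
  assumes "0 \<le> a"
  shows "exponential_density L t * decay a \<bar>t\<bar> = exponential_density ((a + 1) * L) t / (a + 1)"
proof -
  have "exp (- t * L) * decay a t = exp (- t * ((a + 1) * L))"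
    by (simp add: decay_def exp_add[symmetric] algebra_simps)
  then show ?thesis
    using assms by (auto simp: exponential_density_def mult.assoc)
qed

lemma integral_decay [simp]:
  assumes "0 \<le> a"
  shows "(\<integral>t. decay a \<bar>t\<bar> \<partial>law) = 1 / (a + 1)"
proof -
  have pos: "0 < (a + 1) * L" using assms L_pos by simp
  interpret e: prob_space "density lborel (exponential_density ((a + 1) * L))"
    by (rule prob_space_exponential_density[OF pos])
  have "(\<integral>t. 1 \<partial>density lborel (exponential_density ((a + 1) * L))) =
    (\<integral>t. exponential_density ((a + 1) * L) t \<partial>lborel)"
    using pos by (subst integral_density) (auto simp: exponential_density_nonneg)
  then have "(\<integral>t. exponential_density ((a + 1) * L) t \<partial>lborel) = 1"
    using e.prob_space by simp
  then show ?thesis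
    by (subst integral_law) (simp_all add: exponential_density_decay assms)
qed

text \<open>
  Tilting the exponential density of rate \<open>L\<close> by \<open>decay a\<close> gives a multiple of the exponential
  density of rate \<open>(a + 1) * L\<close>, whose tail is known.
\<close>

lemma integral_decay_tail:
  assumes "0 \<le> a" "0 \<le> r"
  shows "(\<integral>t. of_bool (r < \<bar>t\<bar>) * decay a \<bar>t\<bar> \<partial>law) = decay (a + 1) r / (a + 1)"
proof -
  define l where "l = (a + 1) * L"
  define E where "E = density lborel (exponential_density l)"
  have pos: "0 < l" using assms L_pos by (simp add: l_def)
  interpret E: prob_space E
    unfolding E_def by (rule prob_space_exponential_density[OF pos])
  have "distributed E lborel (\<lambda>t. t) (exponential_density l)"
    using pos by (auto simp: distributed_def E_def exponential_density_nonneg intro!: distr_id2)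
  from E.exponential_distributedD_gt[OF this assms(2) pos]
  have "measure E {r<..} = exp (- r * l)"
    by (simp add: E_def greaterThan_def)
  moreover have "measure E {r<..} = (\<integral>t. exponential_density l t * indicator {r<..} t \<partial>lborel)"
  proof -
    have "measure E {r<..} = (\<integral>t. indicator {r<..} t \<partial>E)"
      by (simp add: E_def)
    also have "\<dots> = (\<integral>t. exponential_density l t * indicator {r<..} t \<partial>lborel)"
      unfolding E_def using pos by (subst integral_density) (auto simp: exponential_density_nonneg)
    finally show ?thesis .
  qed
  moreover have "exponential_density L t * (of_bool (r < \<bar>t\<bar>) * decay a \<bar>t\<bar>) =
      exponential_density l t * indicator {r<..} t / (a + 1)" for t
  proof -
    have "exponential_density L t * of_bool (r < \<bar>t\<bar>) = exponential_density L t * indicator {r<..} t"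
      by (auto simp: exponential_density_def indicator_def)
    then have "exponential_density L t * (of_bool (r < \<bar>t\<bar>) * decay a \<bar>t\<bar>) =
        exponential_density L t * indicator {r<..} t * decay a \<bar>t\<bar>"
      by (metis mult.assoc)
    also have "\<dots> = exponential_density L t * decay a \<bar>t\<bar> * indicator {r<..} t"
      by (simp only: mult_ac)
    finally have "exponential_density L t * (of_bool (r < \<bar>t\<bar>) * decay a \<bar>t\<bar>) =
        exponential_density L t * decay a \<bar>t\<bar> * indicator {r<..} t" .
    then show ?thesis
      using exponential_density_decay[OF assms(1), of t] by (simp add: l_def)
  qed
  ultimately show ?thesis
    by (subst integral_law) (simp_all add: decay_def l_def mult_ac)
qed

lemma integral_tail [simp]:
  assumes "0 \<le> r"
  shows "(\<integral>t. of_bool (r < \<bar>t\<bar>) \<partial>law) = decay 1 r"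
  using integral_decay_tail[of 0 r] assms by (simp add: decay_def)

lemma integrable_of_bool [simp]:
  assumes "Measurable.pred borel P"
  shows "integrable law (\<lambda>t. of_bool (P t) :: real)"
  using assms by (intro integrable_law_bounded[where C = 1]) auto

lemma integral_decay_max [simp]:
  assumes "0 \<le> a" "0 \<le> r"
  shows "(\<integral>t. decay a (max r \<bar>t\<bar>) \<partial>law) = decay a r - a / (a + 1) * decay (a + 1) r"
proof -
  have int: "integrable law (\<lambda>t. of_bool (r < \<bar>t\<bar>) * decay a \<bar>t\<bar>)"
    using assms by (intro integrable_law_bounded[where C = 1])
      (measurable, auto simp: decay_le_1 abs_of_pos decay_pos)
  have "(\<integral>t. decay a (max r \<bar>t\<bar>) \<partial>law) =
    (\<integral>t. decay a r - decay a r * of_bool (r < \<bar>t\<bar>) + of_bool (r < \<bar>t\<bar>) * decay a \<bar>t\<bar> \<partial>law)"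
    by (intro Bochner_Integration.integral_cong) (auto simp: max_def)
  also have "\<dots> = decay a r - decay a r * decay 1 r + decay (a + 1) r / (a + 1)"
    using assms int by (simp add: integral_decay_tail law.prob_space del: law.space_eq_univ)
  also have "\<dots> = decay a r - a / (a + 1) * decay (a + 1) r"
    using assms by (simp add: decay_mult field_simps)
  finally show ?thesis .
qed

text \<open>
  The distribution function of the maximum of \<open>k\<close> independent variables with this exponential
  law. For \<open>k = 0\<close> it is the indicator of the positive half-line, which turns the
  recursion below into a statement about indicators of sums.
\<close>

definition max_cdf :: "nat \<Rightarrow> real \<Rightarrow> real" where
  "max_cdf k r = of_bool (0 < r) * (1 - decay 1 r) ^ k"

lemma max_cdf_measurable [measurable]: "max_cdf k \<in> borel_measurable borel"
  unfolding max_cdf_def by measurable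

lemma max_cdf_bounds: "0 \<le> max_cdf k r" "max_cdf k r \<le> 1"
proof -
  have "0 \<le> 1 - decay 1 r" "1 - decay 1 r \<le> 1" if "0 < r"
    using decay_le_1[of 1 r] decay_pos[of 1 r] that by simp_all
  then show "0 \<le> max_cdf k r" "max_cdf k r \<le> 1"
    unfolding max_cdf_def by (auto intro: power_le_one)
qed

lemma integrable_max_cdf [simp]:
  assumes "f \<in> borel_measurable borel"
  shows "integrable law (\<lambda>t. max_cdf k (f t))"
  using assms max_cdf_bounds by (intro integrable_law_bounded[where C = 1]) auto

text \<open>
  Renyi's representation, one step at a time: adding an independent \<open>X / (k + 1)\<close> to the maximum
  of \<open>k\<close> variables gives the law of the maximum of \<open>k + 1\<close> variables. The integrand has the
  explicit antiderivative \<open>F\<close>.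
\<close>

lemma integral_max_cdf:
  "(\<integral>t. max_cdf k (r - \<bar>t\<bar> / (real k + 1)) \<partial>law) = max_cdf (Suc k) r"
proof (cases "0 < r")
  case False
  then have "max_cdf k (r - \<bar>t\<bar> / (real k + 1)) = 0" for t
  proof -
    have "0 \<le> \<bar>t\<bar> / (real k + 1)" by simp
    then have "\<not> 0 < r - \<bar>t\<bar> / (real k + 1)" using False by linarith
    then show ?thesis unfolding max_cdf_def by simp
  qed
  then have "(\<integral>t. max_cdf k (r - \<bar>t\<bar> / (real k + 1)) \<partial>law) = 0" by simp
  then show ?thesis using False by (simp add: max_cdf_def)
next
  case True
  define T where "T = (real k + 1) * r"
  define e where "e = 1 / (real k + 1)"
  define F where "F = (\<lambda>t. - ((decay e t - decay 1 r) ^ Suc k))"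
  define f where "f = (\<lambda>t. L * decay 1 t * (1 - decay 1 (r - t / (real k + 1))) ^ k)"
  have e: "real (Suc k) * e = 1" by (simp add: e_def)
  have T: "0 < T" using True by (simp add: T_def)
  \<comment> \<open>On \<open>{0..<T}\<close> the function \<open>f\<close> is the integrand; beyond \<open>T\<close> the integrand vanishes.\<close>
  have cont: "isCont f t" for t
    unfolding f_def decay_def by (intro continuous_intros) auto
  have deriv: "DERIV F t :> f t" for t
  proof -
    have "decay 1 t = decay e t ^ k * decay e t"
      using decay_power[of e t "Suc k"] by (simp only: e power_Suc2)
    moreover have "decay e t * (1 - decay 1 (r - t / (real k + 1))) = decay e t - decay 1 r"
      using decay_add[of 1 "t / (real k + 1)" "r - t / (real k + 1)"]
      by (simp add: e_def decay_divide algebra_simps)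
    ultimately have "f t = L * decay e t * (decay e t - decay 1 r) ^ k"
      unfolding f_def by (metis (no_types, lifting) mult.assoc mult.commute power_mult_distrib)
    moreover have "DERIV (decay e) t :> - (e * L * decay e t)"
      unfolding decay_def by (auto intro!: derivative_eq_intros)
    then have "DERIV (\<lambda>t. decay e t - decay 1 r) t :> - (e * L * decay e t)"
      by (auto intro!: derivative_eq_intros)
    from DERIV_minus[OF DERIV_power_Suc[OF this, of k]]
    have "DERIV F t :> - ((1 + real k) * (- (e * L * decay e t) * (decay e t - decay 1 r) ^ k))"
      by (simp only: F_def)
    moreover have "- ((1 + real k) * (- (e * L * decay e t) * (decay e t - decay 1 r) ^ k)) =
        (real (Suc k) * e) * (L * decay e t * (decay e t - decay 1 r) ^ k)"
      by (simp add: algebra_simps)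
    ultimately show ?thesis by (simp only: e mult_1)
  qed
  have "(\<integral>t. max_cdf k (r - \<bar>t\<bar> / (real k + 1)) \<partial>law) =
    (\<integral>t. exponential_density L t * max_cdf k (r - \<bar>t\<bar> / (real k + 1)) \<partial>lborel)"
    by (rule integral_law) measurable
  also have "\<dots> = (\<integral>t. f t * indicator {0..T} t \<partial>lborel)"
  proof (rule integral_cong_AE)
    show "AE t in lborel. exponential_density L t * max_cdf k (r - \<bar>t\<bar> / (real k + 1)) =
        f t * indicator {0..T} t"
      using AE_lborel_singleton[of T]
    proof eventually_elim
      case (elim t)
      have "0 < r - t / (real k + 1) \<longleftrightarrow> t < T"
        by (simp add: T_def field_simps)
      with elim show ?case
        by (auto simp: max_cdf_def f_def exponential_density_def indicator_def decay_def mult_ac)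
    qed
    show "(\<lambda>t. f t * indicator {0..T} t) \<in> borel_measurable lborel"
      unfolding f_def by measurable
  qed measurable
  also have "\<dots> = F T - F 0"
    using T by (intro integral_FTC_Icc_real deriv cont) auto
  also have "\<dots> = max_cdf (Suc k) r"
    using True by (simp add: F_def T_def e_def max_cdf_def decay_def)
  finally show ?thesis .
qed

lemma integral_of_bool_less [simp]: "(\<integral>t. of_bool (\<bar>t\<bar> < r) \<partial>law) = max_cdf 1 r"
  using integral_max_cdf[of 0 r] by (simp add: max_cdf_def)

end

lemma measurable_borel4_components:
  "fst \<in> borel_measurable borel4" "(\<lambda>p. fst (snd p)) \<in> borel_measurable borel4"
  "(\<lambda>p. fst (snd (snd p))) \<in> borel_measurable borel4" "(\<lambda>p. snd (snd (snd p))) \<in> borel_measurable borel4"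
proof -
  note snd2 = measurable_compose[OF measurable_snd measurable_snd]
  show "fst \<in> borel_measurable borel4" by (rule measurable_fst)
  show "(\<lambda>p. fst (snd p)) \<in> borel_measurable borel4"
    by (rule measurable_compose[OF measurable_snd measurable_fst])
  show "(\<lambda>p. fst (snd (snd p))) \<in> borel_measurable borel4"
    by (rule measurable_compose[OF snd2 measurable_fst])
  show "(\<lambda>p. snd (snd (snd p))) \<in> borel_measurable borel4"
    by (rule measurable_compose[OF snd2 measurable_snd])
qed

lemma I3_kernel_measurable: "(\<lambda>(a, b, c, d). I3_kernel a b c d) \<in> borel_measurable borel4"
proof -
  have less: "(\<lambda>x. of_bool (f x < g x) :: real) \<in> borel_measurable borel4"
    if "f \<in> borel_measurable borel4" "g \<in> borel_measurable borel4" for f g :: "_ \<Rightarrow> real"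
    unfolding of_bool_def using that by (intro measurable_If borel_measurable_less borel_measurable_const)
  show ?thesis
    unfolding I3_kernel_def case_prod_beta'
    by (intro borel_measurable_diff less borel_measurable_max borel_measurable_add borel_measurable_divide
          measurable_borel4_components borel_measurable_const)
qed

context exponential_law
begin

text \<open>
  The conditional expectation of \<open>I3_kernel\<close> given that its \<open>j\<close>-th argument equals \<open>t \<ge> 0\<close>. The
  first three terms come from the maximum and do not depend on \<open>j\<close>. The last one is
  \<open>exp (- L * t / j)\<close> times \<open>1 / (1 + 1 / i)\<close> for the two other divisors \<open>i\<close> in \<open>{1, 2, 3}\<close>, and
  the product over all three divisors is \<open>1 / 4\<close>.
\<close>

definition proj :: "real \<Rightarrow> real \<Rightarrow> real" where
  "proj j t = decay 1 t - decay 2 t + decay 3 t / 3 - (j + 1) / (4 * j) * decay (1 / j) t"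

text \<open>
  The absolute values change nothing almost surely, but they make the formulas for conditional
  expectations hold at every argument and not just at nonnegative ones. There is no term for \<open>d\<close>:
  its projection vanishes, by Renyi's representation.
\<close>

definition remainder :: "real \<Rightarrow> real \<Rightarrow> real \<Rightarrow> real \<Rightarrow> real" where
  "remainder a b c d = I3_kernel (abs a) (abs b) (abs c) (abs d) - proj 1 (abs a) - proj 2 (abs b) - proj 3 (abs c)"

lemma proj_measurable [measurable]: "proj j \<in> borel_measurable borel"
  unfolding proj_def by measurable

lemma remainder_measurable: "(\<lambda>(a, b, c, d). remainder a b c d) \<in> borel_measurable borel4"
  unfolding remainder_def case_prod_beta'
proof -
  have pr: "(\<lambda>p. proj j (abs (f p))) \<in> borel_measurable borel4" if "f \<in> borel_measurable borel4" for f j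
    by (rule measurable_compose[OF borel_measurable_abs[OF that] proj_measurable])
  show "(\<lambda>p. I3_kernel (abs (fst p)) (abs (fst (snd p))) (abs (fst (snd (snd p))))
        (abs (snd (snd (snd p)))) - proj 1 (abs (fst p)) - proj 2 (abs (fst (snd p)))
        - proj 3 (abs (fst (snd (snd p))))) \<in> borel_measurable borel4"
    by (intro borel_measurable_diff pr measurable_quad[OF I3_kernel_measurable] borel_measurable_abs
        measurable_borel4_components)
qed

lemma abs_proj_le:
  assumes "1 \<le> j"
  shows "\<bar>proj j (abs t)\<bar> \<le> 2"
proof -
  have d: "0 \<le> decay a (abs t)" "decay a (abs t) \<le> 1" if "0 \<le> a" for a
    using that decay_pos[of a "\<bar>t\<bar>"] by (simp_all add: decay_le_1)
  have c: "0 \<le> (j + 1) / (4 * j)" "(j + 1) / (4 * j) \<le> 1 / 2"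
    using assms by (simp_all add: field_simps)
  have "0 \<le> (j + 1) / (4 * j) * decay (1 / j) (abs t)"
    using c d[of "1 / j"] assms by (intro mult_nonneg_nonneg) auto
  moreover have "(j + 1) / (4 * j) * decay (1 / j) (abs t) \<le> 1 / 2 * 1"
    using c d[of "1 / j"] assms by (intro mult_mono) auto
  ultimately show ?thesis
    using d[of 1] d[of 2] d[of 3] unfolding proj_def by linarith
qed

lemma abs_remainder_le: "\<bar>remainder a b c d\<bar> \<le> 7"
proof -
  have "\<bar>I3_kernel (abs a) (abs b) (abs c) (abs d)\<bar> \<le> 1" by (simp add: I3_kernel_def of_bool_def)
  moreover have "\<bar>k - p - q - r\<bar> \<le> 7" if "\<bar>k\<bar> \<le> 1" "\<bar>p\<bar> \<le> 2" "\<bar>q\<bar> \<le> 2" "\<bar>r\<bar> \<le> 2"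
    for k p q r :: real
    using that by linarith
  ultimately show ?thesis
    unfolding remainder_def by (simp add: abs_proj_le)
qed

lemma integrable_proj [simp]: "1 \<le> j \<Longrightarrow> integrable law (\<lambda>t. proj j (abs t))"
  by (rule integrable_law_bounded[where C = 2]) (measurable, simp add: abs_proj_le)

lemma integral_proj [simp]:
  assumes "1 \<le> j"
  shows "(\<integral>t. proj j (abs t) \<partial>law) = 0"
proof -
  have "(\<integral>t. proj j (abs t) \<partial>law) = 1 / 2 - 1 / 3 + 1 / 12 - (j + 1) / (4 * j) * (1 / (1 / j + 1))"
    using assms unfolding proj_def by simp
  also have "\<dots> = 0"
  proof -
    have "1 / j + 1 = (j + 1) / j" "j \<noteq> 0" "j + 1 \<noteq> 0" using assms by (simp_all add: field_simps)
    then show ?thesis by simp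
  qed
  finally show ?thesis .
qed

lemma integral_remainder_last:
  "(\<integral>d. remainder a b c d \<partial>law) =
    decay 1 (max (abs a) (max (abs b) \<bar>c\<bar>)) - decay 1 (abs a) * decay (1/2) (abs b) * decay (1/3) (abs c)
    - proj 1 (abs a) - proj 2 (abs b) - proj 3 (abs c)"
proof -
  have "(\<integral>d. remainder a b c d \<partial>law) =
    (\<integral>d. of_bool (max (abs a) (max (abs b) \<bar>c\<bar>) < \<bar>d\<bar>) - of_bool (\<bar>a\<bar> + \<bar>b\<bar> / 2 + \<bar>c\<bar> / 3 < \<bar>d\<bar>)
      - (proj 1 (abs a) + proj 2 (abs b) + proj 3 (abs c)) \<partial>law)"
    unfolding remainder_def I3_kernel_def by (simp only: diff_diff_eq add.assoc)
  also have "\<dots> = decay 1 (max (abs a) (max (abs b) \<bar>c\<bar>)) - decay 1 (\<bar>a\<bar> + \<bar>b\<bar> / 2 + \<bar>c\<bar> / 3)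
      - (proj 1 (abs a) + proj 2 (abs b) + proj 3 (abs c))"
    by (subst Bochner_Integration.integral_diff, simp, simp)+ (simp add: le_max_iff_disj del: max_less_iff_conj)
  finally show ?thesis by (simp add: decay_add decay_divide)
qed

text \<open>
  This is where the characterization behind the test enters: \<open>X1 + X2 / 2 + X3 / 3\<close> and
  \<open>max X1 (max X2 X3)\<close> have the same law, so the expectation given the last argument is zero.
\<close>

lemma integral_remainder_first:
  "(\<integral>c. (\<integral>b. (\<integral>a. remainder a b c d \<partial>law) \<partial>law) \<partial>law) = 0"
proof -
  have 1: "(\<integral>a. remainder a b c d \<partial>law) =
      max_cdf 1 (abs d) * of_bool (\<bar>b\<bar> < \<bar>d\<bar>) * of_bool (\<bar>c\<bar> < \<bar>d\<bar>)
      - max_cdf 1 (\<bar>d\<bar> - \<bar>c\<bar> / 3 - \<bar>b\<bar> / 2) - proj 2 (abs b) - proj 3 (abs c)" for b c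
  proof -
    have "remainder a b c d =
      of_bool (\<bar>a\<bar> < \<bar>d\<bar>) * (of_bool (\<bar>b\<bar> < \<bar>d\<bar>) * of_bool (\<bar>c\<bar> < \<bar>d\<bar>))
      - of_bool (\<bar>a\<bar> < \<bar>d\<bar> - \<bar>c\<bar> / 3 - \<bar>b\<bar> / 2) - proj 1 (abs a) - proj 2 (abs b) - proj 3 (abs c)" for a
    proof -
      have "\<bar>a\<bar> + \<bar>b\<bar> / 2 + \<bar>c\<bar> / 3 < \<bar>d\<bar> \<longleftrightarrow> \<bar>a\<bar> < \<bar>d\<bar> - \<bar>c\<bar> / 3 - \<bar>b\<bar> / 2" by linarith
      then show ?thesis by (simp add: remainder_def I3_kernel_def of_bool_conj)
    qed
    then show ?thesis by simp
  qed
  have 2: "(\<integral>b. (\<integral>a. remainder a b c d \<partial>law) \<partial>law) =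
      max_cdf 1 (abs d) * max_cdf 1 (abs d) * of_bool (\<bar>c\<bar> < \<bar>d\<bar>)
      - max_cdf 2 (\<bar>d\<bar> - \<bar>c\<bar> / 3) - proj 3 (abs c)" for c
    using integral_max_cdf[of 1 "\<bar>d\<bar> - \<bar>c\<bar> / 3"] unfolding 1 by (simp add: numeral_2_eq_2)
  have "(\<integral>c. (\<integral>b. (\<integral>a. remainder a b c d \<partial>law) \<partial>law) \<partial>law) =
      max_cdf 1 (abs d) * max_cdf 1 (abs d) * max_cdf 1 (abs d) - max_cdf 3 (abs d)"
    using integral_max_cdf[of 2 "\<bar>d\<bar>"] unfolding 2 by (simp add: numeral_3_eq_3)
  also have "\<dots> = 0"
    by (simp add: max_cdf_def power3_eq_cube)
  finally show ?thesis .
qed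

text \<open>
  For the other three arguments the last variable is integrated first: its tail is an exponential,
  so the sum in the kernel factorizes, and the maximum is removed by \<open>integral_decay_max\<close>, one
  variable at a time.
\<close>

lemma degenerate_remainder: "degenerate law remainder"
proof -
  let ?D = "\<lambda>j t. proj j (abs t)"
  have ac: "max x (max y z) = max (max x y) z" "max x (max y z) = max (max x z) y"
    "max x y = max y x" for x y z :: real
    by auto
  have A: "(\<integral>b. (\<integral>c. (\<integral>d. remainder a b c d \<partial>law) \<partial>law) \<partial>law) = 0" for a
  proof -
    have "(\<integral>c. (\<integral>d. remainder a b c d \<partial>law) \<partial>law) =
      decay 1 (max (abs a) \<bar>b\<bar>) - decay 2 (max (abs a) \<bar>b\<bar>) / 2 - decay 1 (abs a) * decay (1/2) (abs b) * 3 / 4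
      - ?D 1 a - ?D 2 b" for b
      unfolding integral_remainder_last ac(1) by (simp add: le_max_iff_disj)
    then show ?thesis by (simp add: proj_def) (simp add: field_simps)
  qed
  have B: "(\<integral>a. (\<integral>c. (\<integral>d. remainder a b c d \<partial>law) \<partial>law) \<partial>law) = 0" for b
  proof -
    have "(\<integral>c. (\<integral>d. remainder a b c d \<partial>law) \<partial>law) =
      decay 1 (max (abs b) \<bar>a\<bar>) - decay 2 (max (abs b) \<bar>a\<bar>) / 2 - decay 1 (abs a) * decay (1/2) (abs b) * 3 / 4
      - ?D 1 a - ?D 2 b" for a
      unfolding integral_remainder_last ac(1)
      by (simp add: le_max_iff_disj max.commute[of "\<bar>b\<bar>" "\<bar>a\<bar>"])
    then show ?thesis by (simp add: proj_def) (simp add: field_simps)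
  qed
  have C: "(\<integral>a. (\<integral>b. (\<integral>d. remainder a b c d \<partial>law) \<partial>law) \<partial>law) = 0" for c
  proof -
    have "(\<integral>b. (\<integral>d. remainder a b c d \<partial>law) \<partial>law) =
      decay 1 (max (abs c) \<bar>a\<bar>) - decay 2 (max (abs c) \<bar>a\<bar>) / 2 - decay 1 (abs a) * decay (1/3) (abs c) * 2 / 3
      - ?D 1 a - ?D 3 c" for a
      unfolding integral_remainder_last ac(2)
      by (simp add: le_max_iff_disj max.commute[of "\<bar>c\<bar>" "\<bar>a\<bar>"])
    then show ?thesis by (simp add: proj_def) (simp add: field_simps)
  qed
  show ?thesis
    unfolding degenerate_def using A B C integral_remainder_first by blast
qed

text \<open>
  The linear part of the statistic: every index occurs in each of the three positions.
\<close>

definition score :: "real \<Rightarrow> real" where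
  "score t = proj 1 (abs t) + proj 2 (abs t) + proj 3 (abs t)"

lemma score_measurable [measurable]: "score \<in> borel_measurable borel"
  unfolding score_def by measurable

lemma abs_score_le: "\<bar>score t\<bar> \<le> 6"
proof -
  have "\<bar>p + q + r\<bar> \<le> 6" if "\<bar>p\<bar> \<le> 2" "\<bar>q\<bar> \<le> 2" "\<bar>r\<bar> \<le> 2" for p q r :: real
    using that by linarith
  then show ?thesis unfolding score_def by (simp add: abs_proj_le)
qed

lemma integral_score: "(\<integral>t. score t \<partial>law) = 0"
  unfolding score_def by simp

lemma integral_score_square: "(\<integral>t. (score t)\<^sup>2 \<partial>law) = 14591 / 1921920"
proof -
  have sq: "(proj 1 s + proj 2 s + proj 3 s)\<^sup>2 =
      25/4 * decay 2 s - 15 * decay 3 s + 14 * decay 4 s - 6 * decay 5 s + decay 6 s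
      + 9/64 * decay 1 s + 1/4 * decay (5/6) s + 1/9 * decay (2/3) s
      - 15/8 * decay (3/2) s + 9/4 * decay (5/2) s - 3/4 * decay (7/2) s
      - 5/3 * decay (4/3) s + 2 * decay (7/3) s - 2/3 * decay (10/3) s" for s
  proof -
    have "proj 1 s + proj 2 s + proj 3 s = 5/2 * decay 1 s - 3 * decay 2 s + decay 3 s
      - 3/8 * decay (1/2) s - 1/3 * decay (1/3) s"
      by (simp add: proj_def)
    then show ?thesis
      by (simp only:) (simp add: power2_eq_square algebra_simps decay_mult)
  qed
  show ?thesis unfolding score_def sq by simp
qed

end

section \<open>Perturbation of weak limits and the limit theorem\<close>

lemma norm_iexp_diff_le: "cmod (iexp a - iexp b) \<le> \<bar>a - b\<bar>"
proof -
  have "iexp a - iexp b = iexp b * (iexp (a - b) - 1)"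
    by (simp add: right_diff_distrib exp_add[symmetric] algebra_simps)
  then have "cmod (iexp a - iexp b) = cmod (iexp (a - b) - 1)"
    by (simp add: norm_mult)
  also have "\<dots> \<le> \<bar>a - b\<bar>"
    using iexp_approx1[of "a - b" 0] by simp
  finally show ?thesis .
qed

context prob_space
begin

text \<open>
  The variance is nonnegative, here for \<open>\<bar>V\<bar>\<close>.
\<close>

lemma expectation_abs_le_sqrt:
  assumes [measurable]: "V \<in> borel_measurable M" and sq: "integrable M (\<lambda>x. (V x)\<^sup>2 :: real)"
  shows "expectation (\<lambda>x. \<bar>V x\<bar>) \<le> sqrt (expectation (\<lambda>x. (V x)\<^sup>2))"
proof -
  have int: "integrable M (\<lambda>x. \<bar>V x\<bar>)"
    by (rule square_integrable_imp_integrable) (use sq in simp_all)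
  have "0 \<le> variance (\<lambda>x. \<bar>V x\<bar>)" by (rule variance_positive)
  also have "\<dots> = expectation (\<lambda>x. (V x)\<^sup>2) - (expectation (\<lambda>x. \<bar>V x\<bar>))\<^sup>2"
    using variance_eq[OF int] sq by simp
  finally show ?thesis by (intro real_le_rsqrt) simp
qed

lemma char_distr_diff_le:
  fixes W Z :: "'a \<Rightarrow> real"
  assumes [measurable]: "W \<in> borel_measurable M" "Z \<in> borel_measurable M"
    and sq: "integrable M (\<lambda>x. (W x - Z x)\<^sup>2)"
  shows "cmod (char (distr M borel W) t - char (distr M borel Z) t) \<le>
    \<bar>t\<bar> * sqrt (expectation (\<lambda>x. (W x - Z x)\<^sup>2))"
proof -
  have int: "integrable M (\<lambda>x. W x - Z x)"
    by (rule square_integrable_imp_integrable) (use sq in simp_all)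
  have ii: "integrable M (\<lambda>x. iexp (t * V x))" if "V \<in> borel_measurable M" for V :: "'a \<Rightarrow> real"
    using that by (intro integrable_iexp) auto
  have "char (distr M borel W) t - char (distr M borel Z) t =
    (CLINT x|M. iexp (t * W x) - iexp (t * Z x))"
    unfolding char_def by (simp add: integral_distr ii del: of_real_mult)
  then have "cmod (char (distr M borel W) t - char (distr M borel Z) t) \<le>
    (\<integral>x. cmod (iexp (t * W x) - iexp (t * Z x)) \<partial>M)"
    by (simp only: integral_norm_bound)
  also have "\<dots> \<le> (\<integral>x. \<bar>t\<bar> * \<bar>W x - Z x\<bar> \<partial>M)"
  proof (rule integral_mono)
    show "integrable M (\<lambda>x. cmod (iexp (t * W x) - iexp (t * Z x)))"
      by (intro integrable_norm Bochner_Integration.integrable_diff ii) measurable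
    show "cmod (iexp (t * W x) - iexp (t * Z x)) \<le> \<bar>t\<bar> * \<bar>W x - Z x\<bar>" for x
      using norm_iexp_diff_le[of "t * W x" "t * Z x"]
      by (simp only: right_diff_distrib[symmetric] abs_mult)
  qed (use int in simp)
  also have "\<dots> \<le> \<bar>t\<bar> * sqrt (expectation (\<lambda>x. (W x - Z x)\<^sup>2))"
    using expectation_abs_le_sqrt[of "\<lambda>x. W x - Z x"] sq by (simp add: mult_left_mono)
  finally show ?thesis .
qed

text \<open>
  Slutsky's lemma for a perturbation that is small in mean square: characteristic functions are
  Lipschitz with respect to the \<open>L\<^sup>2\<close> distance, so Levy's continuity theorem applies twice.
\<close>

lemma weak_conv_m_L2_perturbation:
  fixes W Z :: "nat \<Rightarrow> 'a \<Rightarrow> real"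
  assumes W: "\<And>n. W n \<in> borel_measurable M" and Z: "\<And>n. Z n \<in> borel_measurable M"
    and sq: "\<And>n. integrable M (\<lambda>x. (W n x - Z n x)\<^sup>2)"
    and lim: "(\<lambda>n. expectation (\<lambda>x. (W n x - Z n x)\<^sup>2)) \<longlonglongrightarrow> 0"
    and N: "real_distribution N" and conv: "weak_conv_m (\<lambda>n. distr M borel (Z n)) N"
  shows "weak_conv_m (\<lambda>n. distr M borel (W n)) N"
proof (rule levy_continuity[OF _ N])
  show "real_distribution (distr M borel (W n))" for n by (rule real_distribution_distr[OF W])
  fix t
  have "(\<lambda>n. char (distr M borel (Z n)) t) \<longlonglongrightarrow> char N t"
    by (rule levy_continuity1[OF real_distribution_distr[OF Z] N conv])
  moreover have "(\<lambda>n. char (distr M borel (W n)) t - char (distr M borel (Z n)) t) \<longlonglongrightarrow> 0"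
  proof (rule Lim_null_comparison)
    show "\<forall>\<^sub>F n in sequentially. cmod (char (distr M borel (W n)) t - char (distr M borel (Z n)) t) \<le>
        \<bar>t\<bar> * sqrt (expectation (\<lambda>x. (W n x - Z n x)\<^sup>2))"
      by (intro always_eventually allI char_distr_diff_le W Z sq)
    show "(\<lambda>n. \<bar>t\<bar> * sqrt (expectation (\<lambda>x. (W n x - Z n x)\<^sup>2))) \<longlonglongrightarrow> 0"
      using tendsto_mult_right_zero[OF tendsto_real_sqrt[OF lim, simplified], of "\<bar>t\<bar>"] by simp
  qed
  ultimately show "(\<lambda>n. char (distr M borel (W n)) t) \<longlonglongrightarrow> char N t"
    using tendsto_add by fastforce
qed

lemma weak_conv_m_scale_normal:
  fixes Z :: "nat \<Rightarrow> 'a \<Rightarrow> real"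
  assumes Z[measurable]: "\<And>n. Z n \<in> borel_measurable M" and \<sigma>: "0 < \<sigma>"
    and conv: "weak_conv_m (\<lambda>n. distr M borel (Z n)) std_normal_distribution"
  shows "weak_conv_m (\<lambda>n. distr M borel (\<lambda>x. \<sigma> * Z n x)) (density lborel (normal_density 0 \<sigma>))"
proof -
  interpret s: real_distribution std_normal_distribution
    by (rule real_dist_normal_dist)
  have "distributed std_normal_distribution lborel (\<lambda>x. x) (normal_density 0 1)"
    by (auto simp: distributed_def intro!: distr_id2)
  from s.normal_density_affine[OF this, of \<sigma> 0] \<sigma>
  have "distr std_normal_distribution lborel (\<lambda>x. \<sigma> * x) = density lborel (normal_density 0 \<sigma>)"
    by (simp add: distributed_def)
  moreover have "distr std_normal_distribution lborel (\<lambda>x. \<sigma> * x) =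
      distr std_normal_distribution borel (\<lambda>x. \<sigma> * x)"
    by (rule distr_cong) auto
  ultimately have N: "density lborel (normal_density 0 \<sigma>) = distr std_normal_distribution borel (\<lambda>x. \<sigma> * x)"
    by simp
  show ?thesis
    unfolding N
  proof (rule levy_continuity)
    show "real_distribution (distr M borel (\<lambda>x. \<sigma> * Z n x))" for n
      by (rule real_distribution_distr) measurable
    show "real_distribution (distr std_normal_distribution borel (\<lambda>x. \<sigma> * x))"
      by (rule s.real_distribution_distr) measurable
    fix t
    have "(\<lambda>n. char (distr M borel (Z n)) (t * \<sigma>)) \<longlonglongrightarrow> char std_normal_distribution (t * \<sigma>)"
      by (rule levy_continuity1[OF real_distribution_distr[OF Z] s.real_distribution_axioms conv])
    then show "(\<lambda>n. char (distr M borel (\<lambda>x. \<sigma> * Z n x)) t) \<longlonglongrightarrow>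
        char (distr std_normal_distribution borel (\<lambda>x. \<sigma> * x)) t"
      unfolding char_def by (simp add: integral_distr mult.assoc)
  qed
qed

lemma integral_iid_sequence:
  fixes X :: "nat \<Rightarrow> 'a \<Rightarrow> real" and f :: "(nat \<Rightarrow> real) \<Rightarrow> real"
  assumes indep: "indep_vars (\<lambda>_. borel) X UNIV"
    and law: "\<And>i. distr M borel (X i) = N"
    and f: "f \<in> borel_measurable (Pi\<^sub>M UNIV (\<lambda>_. N))"
  shows "expectation (\<lambda>\<omega>. f (\<lambda>i. X i \<omega>)) = (\<integral>x. f x \<partial>Pi\<^sub>M UNIV (\<lambda>_. N))"
proof -
  have X[measurable]: "X i \<in> borel_measurable M" for i
    using indep by (simp add: indep_vars_def2)
  have "distr M (Pi\<^sub>M UNIV (\<lambda>_. borel)) (\<lambda>\<omega> i. X i \<omega>) = Pi\<^sub>M UNIV (\<lambda>_. N)"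
    using indep_vars_iff_distr_eq_PiM[of UNIV X "\<lambda>_. borel"] indep law by (simp add: restrict_UNIV)
  moreover have "sets N = sets borel" using law[of 0] by (metis sets_distr)
  then have "f \<in> borel_measurable (Pi\<^sub>M UNIV (\<lambda>_. borel))"
    using f by (simp cong: measurable_cong_sets sets_PiM_cong)
  then have "(\<integral>x. f x \<partial>distr M (Pi\<^sub>M UNIV (\<lambda>_. borel)) (\<lambda>\<omega> i. X i \<omega>)) = expectation (\<lambda>\<omega>. f (\<lambda>i. X i \<omega>))"
    by (subst integral_distr) (auto intro: measurable_abs_UNIV)
  ultimately show ?thesis by simp
qed

end

context exponential_law
begin

text \<open>
  In the sum of \<open>proj\<close> over quadruples three of the four indices are free, which gives the factor
  \<open>n ^ 3\<close>.
\<close>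

lemma sum_remainder:
  assumes "n > 0" "\<And>i. 0 \<le> x i"
  shows "(\<Sum>(i, j, k, l)\<in>quads n. remainder (x i) (x j) (x k) (x l)) =
    real n ^ 4 * (I3 n x - (\<Sum>i<n. score (x i)) / real n)"
proof -
  have "(\<Sum>(i, j, k, l)\<in>quads n. remainder (x i) (x j) (x k) (x l)) =
     (\<Sum>(i, j, k, l)\<in>quads n. I3_kernel (x i) (x j) (x k) (x l)) -
     (\<Sum>(i, j, k, l)\<in>quads n. proj 1 (abs (x i)) + proj 2 (abs (x j)) + proj 3 (abs (x k)))"
    using assms(2) by (simp add: remainder_def case_prod_beta' sum_subtractf[symmetric] algebra_simps)
  also have "(\<Sum>(i, j, k, l)\<in>quads n. I3_kernel (x i) (x j) (x k) (x l)) = real n ^ 4 * I3 n x"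
    using assms(1) by (simp add: I3_eq)
  also have "(\<Sum>(i, j, k, l)\<in>quads n. proj 1 (abs (x i)) + proj 2 (abs (x j)) + proj 3 (abs (x k))) =
     real n ^ 3 * (\<Sum>i<n. score (x i))"
    unfolding sum_quads
    by (simp add: sum.distrib sum_distrib_left[symmetric] score_def power3_eq_cube algebra_simps)
  finally show ?thesis
    using assms(1) by (simp add: right_diff_distrib power_numeral_reduce)
qed

lemma AE_law_nonneg: "AE t in law. 0 \<le> t"
  unfolding law_def by (subst AE_density) (auto simp: exponential_density_def)

end

theorem mainTheorem7:
  fixes M :: "'a measure" and X :: "nat \<Rightarrow> 'a \<Rightarrow> real" and rate :: real
  assumes "prob_space M"
    and "rate > 0"
    and "prob_space.indep_vars M (\<lambda>_. borel) X UNIV"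
    and "\<And>i. distributed M lborel (X i) (exponential_density rate)"
  shows "weak_conv_m
           (\<lambda>n. distr M borel (\<lambda>\<omega>. sqrt (real n) * I3 n (\<lambda>i. X i \<omega>)))
           (density lborel (normal_density 0 (sqrt (14591 / 1921920))))"
proof -
  interpret prob_space M by fact
  interpret e: exponential_law rate by unfold_locales fact
  note indep = assms(3)
  have X[measurable]: "X i \<in> borel_measurable M" for i
    using indep by (simp add: indep_vars_def2)
  have law: "distr M borel (X i) = e.law" for i
  proof -
    have "distr M borel (X i) = distr M lborel (X i)" by (rule distr_cong) auto
    then show ?thesis using assms(4)[of i] by (simp add: distributed_def e.law_def)
  qed
  define \<sigma> where "\<sigma> = sqrt (14591 / 1921920)"
  have \<sigma>: "0 < \<sigma>" "\<sigma>\<^sup>2 = 14591 / 1921920" by (simp_all add: \<sigma>_def)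
  define Y where "Y i \<omega> = e.score (X i \<omega>)" for i \<omega>
  define W where "W n \<omega> = sqrt (real n) * I3 n (\<lambda>i. X i \<omega>)" for n \<omega>
  \<comment> \<open>\<open>Z\<close> is the sum of scores over \<open>sqrt n\<close>, written so that the central limit theorem applies to
  the factor of \<open>\<sigma>\<close>.\<close>
  define Z where "Z n \<omega> = \<sigma> * ((\<Sum>i<n. Y i \<omega>) / sqrt (real n * \<sigma>\<^sup>2))" for n \<omega>
  have Y[measurable]: "Y i \<in> borel_measurable M" for i
    unfolding Y_def by measurable
  have expX: "expectation (\<lambda>\<omega>. g (X i \<omega>)) = (\<integral>t. g t \<partial>e.law)" if "g \<in> borel_measurable borel"
    for g :: "real \<Rightarrow> real" and i
    using that by (simp add: law[of i, symmetric] integral_distr)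
  have clt: "weak_conv_m (\<lambda>n. distr M borel (\<lambda>\<omega>. (\<Sum>i<n. Y i \<omega>) / sqrt (real n * \<sigma>\<^sup>2)))
      std_normal_distribution"
  proof (rule central_limit_theorem_zero_mean)
    show "indep_vars (\<lambda>_. borel) Y UNIV"
      unfolding Y_def by (rule indep_vars_compose2[OF indep]) measurable
    show mean: "expectation (Y i) = 0" for i
      unfolding Y_def using expX[of e.score i] by (simp add: e.integral_score)
    show "\<sigma> > 0" by (rule \<sigma>(1))
    show "integrable M (\<lambda>\<omega>. (Y i \<omega>)\<^sup>2)" for i
    proof (rule integrable_const_bound[where B = "6\<^sup>2"])
      show "AE \<omega> in M. norm ((Y i \<omega>)\<^sup>2) \<le> 6\<^sup>2"
        using e.abs_score_le abs_le_square_iff[of _ "6 :: real"] by (simp add: Y_def)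
    qed measurable
    show "variance (Y i) = \<sigma>\<^sup>2" for i
      using expX[of "\<lambda>t. (e.score t)\<^sup>2" i] by (simp add: mean) (simp add: Y_def e.integral_score_square \<sigma>)
    show "distr M borel (Y i) = distr e.law borel e.score" for i
      unfolding law[of i, symmetric] Y_def by (subst distr_distr) (auto simp: comp_def)
  qed
  have W[measurable]: "W n \<in> borel_measurable M" for n
    unfolding W_def I3_eq case_prod_beta'
    by (intro borel_measurable_times borel_measurable_divide borel_measurable_sum measurable_quad[OF I3_kernel_measurable])
       simp_all
  have Z[measurable]: "Z n \<in> borel_measurable M" for n
    unfolding Z_def by measurable
  have Z_conv: "weak_conv_m (\<lambda>n. distr M borel (Z n)) (density lborel (normal_density 0 \<sigma>))"
    unfolding Z_def by (rule weak_conv_m_scale_normal[OF _ \<sigma>(1) clt]) measurable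
  define R where "R n x = (\<Sum>(i, j, k, l)\<in>quads n. e.remainder (x i) (x j) (x k) (x l))"
    for n and x :: "nat \<Rightarrow> real"
  have R_eq: "R n x = (\<Sum>p\<in>quads n. e.remainder (x (fst p)) (x (fst (snd p)))
      (x (fst (snd (snd p)))) (x (snd (snd (snd p)))))" for n x
    by (simp add: R_def case_prod_beta')
  have R_iid: "R n \<in> borel_measurable e.law.iid" for n
    unfolding R_eq
    by (intro borel_measurable_sum measurable_quad[OF e.remainder_measurable] e.law.borel_measurable_coord)
  have RX[measurable]: "(\<lambda>\<omega>. R n (\<lambda>i. X i \<omega>)) \<in> borel_measurable M" for n
    unfolding R_eq
    by (intro borel_measurable_sum measurable_quad[OF e.remainder_measurable] X)
  have "AE \<omega> in M. 0 \<le> X i \<omega>" for i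
    using e.AE_law_nonneg unfolding law[of i, symmetric] by (subst (asm) AE_distr_iff) auto
  then have nonneg: "AE \<omega> in M. \<forall>i. 0 \<le> X i \<omega>"
    by (simp add: AE_all_countable)
  have diff: "AE \<omega> in M. (W n \<omega> - Z n \<omega>)\<^sup>2 = (R n (\<lambda>i. X i \<omega>))\<^sup>2 / real n ^ 7" for n
    using nonneg
  proof eventually_elim
    case (elim \<omega>)
    show ?case
    proof (cases "n = 0")
      case False
      define S where "S = (\<Sum>i<n. Y i \<omega>)"
      have n: "0 < real n" using False by simp
      have "R n (\<lambda>i. X i \<omega>) = real n ^ 4 * (I3 n (\<lambda>i. X i \<omega>) - S / real n)"
        using False elim unfolding R_def S_def Y_def by (subst e.sum_remainder) auto
      moreover have "W n \<omega> - Z n \<omega> = sqrt (real n) * (I3 n (\<lambda>i. X i \<omega>) - S / real n)"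
      proof -
        have "Z n \<omega> = S / sqrt (real n)"
          using \<sigma>(1) by (simp add: Z_def S_def real_sqrt_mult)
        also have "\<dots> = sqrt (real n) * (S / real n)"
          using n by (simp add: field_simps)
        finally show ?thesis by (simp add: W_def right_diff_distrib)
      qed
      moreover have "(sqrt r * D)\<^sup>2 = (r ^ 4 * D)\<^sup>2 / r ^ 7" if "0 < r" for r D :: real
        using that by (simp add: power_mult_distrib) (simp add: power_numeral_reduce)
      ultimately show ?thesis
        using n by simp
    qed (simp add: W_def Z_def R_def)
  qed
  have R_bound: "\<bar>R n x\<bar> \<le> 7 * real n ^ 4" for n x
  proof -
    have "\<bar>R n x\<bar> \<le> (\<Sum>p\<in>quads n. 7)"
      unfolding R_eq by (rule order_trans[OF sum_abs]) (intro sum_mono e.abs_remainder_le)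
    then show ?thesis by (simp add: power_numeral_reduce)
  qed
  have int_R: "integrable M (\<lambda>\<omega>. (R n (\<lambda>i. X i \<omega>))\<^sup>2 / real n ^ 7)" for n
  proof (rule integrable_divide_zero, rule integrable_const_bound[where B = "(7 * real n ^ 4)\<^sup>2"])
    have "(R n x)\<^sup>2 \<le> (7 * real n ^ 4)\<^sup>2" for x
      using R_bound[of n x] by (intro abs_le_square_iff[THEN iffD1]) simp
    then show "AE \<omega> in M. norm ((R n (\<lambda>i. X i \<omega>))\<^sup>2) \<le> (7 * real n ^ 4)\<^sup>2"
      by (intro AE_I2) simp
  qed measurable
  have sq: "integrable M (\<lambda>\<omega>. (W n \<omega> - Z n \<omega>)\<^sup>2)" for n
  proof (rule integrable_cong_AE_imp[OF int_R[of n]])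
    show "AE \<omega> in M. (R n (\<lambda>i. X i \<omega>))\<^sup>2 / real n ^ 7 = (W n \<omega> - Z n \<omega>)\<^sup>2"
      using diff[of n] by eventually_elim (rule sym)
  qed measurable
  \<comment> \<open>The order \<open>n ^ 6\<close> of the second moment against the normalization \<open>n ^ 7\<close> leaves \<open>1 / n\<close>.\<close>
  have le: "expectation (\<lambda>\<omega>. (W n \<omega> - Z n \<omega>)\<^sup>2) \<le> 6 ^ 8 * 7\<^sup>2 / real n" for n
  proof -
    have "expectation (\<lambda>\<omega>. (W n \<omega> - Z n \<omega>)\<^sup>2) = expectation (\<lambda>\<omega>. (R n (\<lambda>i. X i \<omega>))\<^sup>2 / real n ^ 7)"
      using diff[of n] by (intro integral_cong_AE) measurable
    also have "\<dots> = expectation (\<lambda>\<omega>. (R n (\<lambda>i. X i \<omega>))\<^sup>2) / real n ^ 7" by simp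
    also have "expectation (\<lambda>\<omega>. (R n (\<lambda>i. X i \<omega>))\<^sup>2) = (\<integral>x. (R n x)\<^sup>2 \<partial>e.law.iid)"
      by (rule integral_iid_sequence[OF indep law]) (intro borel_measurable_power R_iid)
    also have "\<dots> / real n ^ 7 \<le> 6 ^ 8 * real n ^ 6 * 7\<^sup>2 / real n ^ 7"
      unfolding R_def
      by (intro divide_right_mono e.law.degenerate_second_moment[OF e.remainder_measurable
            e.abs_remainder_le e.degenerate_remainder]) simp
    also have "\<dots> = 6 ^ 8 * 7\<^sup>2 / real n"
      by (cases "n = 0") (simp_all add: power_numeral_reduce)
    finally show ?thesis .
  qed
  have lim: "(\<lambda>n. expectation (\<lambda>\<omega>. (W n \<omega> - Z n \<omega>)\<^sup>2)) \<longlonglongrightarrow> 0"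
  proof (rule Lim_null_comparison)
    show "\<forall>\<^sub>F n in sequentially. norm (expectation (\<lambda>\<omega>. (W n \<omega> - Z n \<omega>)\<^sup>2)) \<le> 6 ^ 8 * 7\<^sup>2 / real n"
      using le by (intro always_eventually allI) (simp add: integral_nonneg_AE)
    show "(\<lambda>n. 6 ^ 8 * 7\<^sup>2 / real n) \<longlonglongrightarrow> 0"
      by (rule lim_const_over_n)
  qed
  have "real_distribution (density lborel (normal_density 0 \<sigma>))"
    using prob_space_normal_density[OF \<sigma>(1), of 0]
    by (intro real_distribution.intro real_distribution_axioms.intro) simp_all
  from weak_conv_m_L2_perturbation[OF W Z sq lim this Z_conv] show ?thesis
    unfolding W_def \<sigma>_def .
qed

end
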